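(* For every positive odd integer $n$ there is a handle $H$ such that the Collatz Series starting from $H$ reaches $n$ after fewer than $8$ steps, where one step is either one "up" operation or one "down" operation (zero steps being allowed).
   Context: The Collatz Series starting from a positive integer is the sequence generated by recursively applying the Collatz rules: the "up" operation $m\mapsto 3m+1$ if $m$ is odd, and the "down" operation $m\mapsto m/2$ if $m$ is even. A handle is a positive odd integer divisible by $3$. *)

theory Defs
  imports Main
begin

definition collatz_step :: "nat \<Rightarrow> nat" where
  "collatz_step m = (if odd m then 3 * m + 1 else m div 2)"

definition collatz_series :: "nat \<Rightarrow> nat \<Rightarrow> nat" where
  "collatz_series m k = (collatz_step ^^ k) m"

definition handle :: "nat \<Rightarrow> bool" where
  "handle h \<longleftrightarrow> h > 0 \<and> odd h \<and> 3 dvd h"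

end

(* An odd multiple of 3 is itself a handle. Otherwise n is a unit modulo 9, and since 2 is
   a primitive root modulo 9 there is an exponent e with 1 <= e <= 6 and 2^e n = 1 (mod 9).
   Then H = (2^e n - 1) / 3 is a handle, and one "up" followed by e "down" operations
   lead from H to n. *)
theory Submission
  imports Defs
begin

lemma collatz_step_funpow_power_two:
  "(collatz_step ^^ e) (2 ^ e * n) = n"
proof (induction e)
  case (Suc e)
  have "collatz_step (2 ^ Suc e * n) = 2 ^ e * n"
    by (simp add: collatz_step_def)
  with Suc show ?case
    by (simp add: funpow_Suc_right del: funpow.simps power_Suc)
qed simp

text \<open>Congruence to 1 modulo 3 would already give a predecessor of \<open>2 ^ e * n\<close>
  under the "up" operation; modulo 9 makes that predecessor a multiple of 3 as well.\<close>

lemma handle_reaches_if_power_two_mult_mod_9: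
  assumes "e > 0" and "2 ^ e * n mod 9 = (1::nat)"
  shows "\<exists>H. handle H \<and> collatz_series H (Suc e) = n"
proof -
  \<comment> \<open>The handle will be \<open>3 * q\<close>, which equals (2^e n - 1) / 3.\<close>
  define q where "q = 2 ^ e * n div 9"
  have eq: "2 ^ e * n = 9 * q + 1"
    using assms(2) div_mult_mod_eq[of "2 ^ e * n" 9] unfolding q_def by linarith
  \<comment> \<open>Here \<open>e > 0\<close> matters: evenness of \<open>9 * q + 1\<close> forces
    \<open>q\<close> to be odd, so \<open>3 * q\<close> is odd and positive.\<close>
  have "even (2 ^ e * n)"
    using assms(1) by simp
  then have "odd q"
    unfolding eq by simp
  then have "handle (3 * q)"
    by (auto simp: handle_def intro: Nat.gr0I)
  moreover have "collatz_step (3 * q) = 2 ^ e * n"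
    using \<open>odd q\<close> eq by (simp add: collatz_step_def)
  then have "collatz_series (3 * q) (Suc e) = n"
    by (simp add: collatz_series_def funpow_Suc_right collatz_step_funpow_power_two
        del: funpow.simps)
  ultimately show ?thesis
    by blast
qed

lemma power_two_inverse_mod_9:
  fixes n :: nat
  assumes "\<not> 3 dvd n"
  shows "\<exists>e\<in>{1..6}. 2 ^ e * n mod 9 = 1"
proof -
  define r where "r = n mod 9"
  have "r < 9" and "\<not> 3 dvd r"
    using assms by (simp_all add: r_def dvd_mod_iff)
  from \<open>r < 9\<close> have "r \<in> {0, 1, 2, 3, 4, 5, 6, 7, 8}"
    by auto
  with \<open>\<not> 3 dvd r\<close> have "r \<in> {1, 2, 4, 5, 7, 8}"
    by auto
  \<comment> \<open>The disjuncts follow the residues 1, 2, 4, 5, 7, 8 in this order. For residue 1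
    the exponent is 6 instead of 0, which keeps it positive.\<close>
  then have "2 ^ 6 * r mod 9 = 1 \<or> 2 ^ 5 * r mod 9 = 1 \<or> 2 ^ 4 * r mod 9 = 1
      \<or> 2 ^ 1 * r mod 9 = 1 \<or> 2 ^ 2 * r mod 9 = 1 \<or> 2 ^ 3 * r mod 9 = 1"
    by auto
  then have "\<exists>e\<in>{1..6}. 2 ^ e * r mod 9 = 1"
    by (elim disjE) (rule bexI, assumption, simp)+
  then show ?thesis
    by (simp only: r_def mod_mult_right_eq)
qed

theorem proposition5p1:
  fixes n :: nat
  assumes "n > 0" and "odd n"
  shows "\<exists>H. handle H \<and> (\<exists>k<8. collatz_series H k = n)"
proof (cases "3 dvd n")
  case True
  then have "handle n" and "collatz_series n 0 = n"
    using assms by (simp_all add: handle_def collatz_series_def)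
  then show ?thesis
    by (intro exI[of _ n] conjI exI[of _ 0]) simp_all
next
  case False
  then obtain e where "e \<in> {1..6}" and "2 ^ e * n mod 9 = 1"
    using power_two_inverse_mod_9 by blast
  then obtain H where "handle H" "collatz_series H (Suc e) = n"
    using handle_reaches_if_power_two_mult_mod_9[of e n] by auto
  \<comment> \<open>One "up" and at most six "down" operations make at most 7 steps.\<close>
  with \<open>e \<in> {1..6}\<close> show ?thesis
    by (intro exI[of _ H] conjI exI[of _ "Suc e"]) simp_all
qed

end
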